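(* (Artin's Theorem for Lie algebras) Let $k$ be a field and let $G$ be a finite group whose order $|G|$ is invertible in $k$, acting on a Lie algebra $\mathfrak{h}$ over $k$ via a morphism of groups $\varphi: G\to\mathrm{Aut}_{\mathrm{Lie}}(\mathfrak{h})$. Let $\mathfrak{h}^G\subseteq\mathfrak{h}$ be the subalgebra of invariants and $V=\ker(t)$, where $t:\mathfrak{h}\to\mathfrak{h}^G$ is the trace map. Then: (1) The map $$\mathfrak{h}^G\,\#^{\bullet}\,V\to\mathfrak{h},\qquad (g,x)\mapsto g+x\qquad (g\in\mathfrak{h}^G,\ x\in V)$$ is an isomorphism of Lie algebras, where $\mathfrak{h}^G\,\#^{\bullet}\,V$ is the skew crossed product of Lie algebras having the bracket $$[(g,x),(g',x')] := \Bigl([g,g']+|G|^{-1}\sum_{\gamma\in G}[\gamma\triangleright x,\gamma\triangleright x'],\ \ [x,x']-|G|^{-1}\sum_{\gamma\in G}[\gamma\triangleright x,\gamma\triangleright x']+[x,g']-[x',g]\Bigr)$$ for all $g,g'\in\mathfrak{h}^G$ and $x,x'\in V$. (2) The map $$\Omega:\mathbb{G}_{\mathfrak{h}^G}^V(\varphi)\to\mathrm{Gal}(\mathfrak{h}/\mathfrak{h}^G),\qquad \Omega(\sigma,r)(g+x):=g+r(x)+\sigma(x),$$ for all $(\sigma,r)\in\mathbb{G}_{\mathfrak{h}^G}^V(\varphi)$, $g\in\mathfrak{h}^G$ and $x\in V$, is an isomorphism of groups, where $\mathbb{G}_{\mathfrak{h}^G}^V(\varphi)$ is the subgroup of $\mathrm{GL}_k(V)\rtimes\mathrm{Hom}_k(V,\mathfrak{h}^G)$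 defined in the context.
   Context: Action: write $\gamma\triangleright x:=\varphi(\gamma)(x)$ for $\gamma\in G$, $x\in\mathfrak{h}$. The subalgebra of invariants is $\mathfrak{h}^G:=\{x\in\mathfrak{h}\mid\gamma\triangleright x=x\ \forall\gamma\in G\}$. The trace map (Reynolds operator) is $t:\mathfrak{h}\to\mathfrak{h}^G$, $t(x):=|G|^{-1}\sum_{\gamma\in G}\gamma\triangleright x$; it is a linear retraction of the inclusion $\mathfrak{h}^G\subseteq\mathfrak{h}$, so $\mathfrak{h}=\mathfrak{h}^G\oplus V$ as vector spaces. Galois group: for a Lie subalgebra $\mathfrak{g}\subseteq\mathfrak{h}$, $\mathrm{Gal}(\mathfrak{h}/\mathfrak{g}):=\{\sigma\in\mathrm{Aut}_{\mathrm{Lie}}(\mathfrak{h})\mid\sigma(g)=g\ \forall g\in\mathfrak{g}\}$. Skew crossed product: let $\mathfrak{g}$ be a Lie algebra, $V$ a vector space, and $\leftharpoonup:V\times\mathfrak{g}\to V$, $\theta:V\times V\to\mathfrak{g}$, $\{-,-\}:V\times V\to V$ bilinear maps such that for all $a,b\in\mathfrak{g}$, $x,y,z\in V$ (with $\sum_{(c)}$ the sum over cyclic permutations of $x,y,z$): (T1) $x\leftharpoonup[a,b]=(x\leftharpoonup a)\leftharpoonup b-(x\leftharpoonup b)\leftharpoonup a$ (i.e. $(V,\leftharpoonup)$ is a right Lie $\mathfrak{g}$-module), $\theta(x,x)=0$ and $\{x,x\}=0$; (T2) $\{x,y\}\leftharpoonup a=\{x,y\leftharpoonup a\}+\{x\leftharpoonup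 a,y\}$; (T3) $[\theta(x,y),a]=\theta(x,y\leftharpoonup a)+\theta(x\leftharpoonup a,y)$; (T4) $\sum_{(c)}\theta(x,\{y,z\})=0$; (T5) $\sum_{(c)}\{x,\{y,z\}\}+\sum_{(c)}x\leftharpoonup\theta(y,z)=0$. The skew crossed product $\mathfrak{g}\,\#^{\bullet}\,V$ is the Lie algebra on $\mathfrak{g}\times V$ with bracket $[(a,x),(b,y)]:=([a,b]+\theta(x,y),\ \{x,y\}+x\leftharpoonup b-y\leftharpoonup a)$. The skew crossed product $\mathfrak{h}^G\,\#^{\bullet}\,V$ in the theorem is the one for $\mathfrak{g}=\mathfrak{h}^G$, $V=\ker(t)$ and, for $x,y\in V$, $g\in\mathfrak{h}^G$, $$x\leftharpoonup g=[x,g],\quad\theta(x,y)=|G|^{-1}\sum_{\gamma\in G}[\gamma\triangleright x,\gamma\triangleright y],\quad\{x,y\}=[x,y]-|G|^{-1}\sum_{\gamma\in G}[\gamma\triangleright x,\gamma\triangleright y].$$ Semidirect product: $\mathrm{GL}_k(V)\rtimes\mathrm{Hom}_k(V,\mathfrak{h}^G)$ is the set $\mathrm{GL}_k(V)\times\mathrm{Hom}_k(V,\mathfrak{h}^G)$ with multiplication $(\sigma,r)\cdot(\sigma',r'):=(\sigma\circ\sigma',\ r\circ\sigma'+r')$. The group $\mathbb{G}_{\mathfrak{h}^G}^V(\varphi)$ is the set of all pairs $(\sigma,r)\in\mathrm{GL}_k(V)\times\mathrm{Hom}_k(V,\mathfrak{h}^G)$ such that for all $g\in\mathfrak{h}^G$,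 $x,y\in V$, with $\theta(x,y)=|G|^{-1}\sum_{\gamma\in G}[\gamma\triangleright x,\gamma\triangleright y]$ and $\{x,y\}=[x,y]-|G|^{-1}\sum_{\gamma\in G}[\gamma\triangleright x,\gamma\triangleright y]$: $\sigma([x,g])=[\sigma(x),g]$; $r([x,g])=[r(x),g]$; $\sigma(\{x,y\})=\{\sigma(x),\sigma(y)\}+[\sigma(x),r(y)]+[r(x),\sigma(y)]$; $r(\{x,y\})=[r(x),r(y)]+\theta(\sigma(x),\sigma(y))-\theta(x,y)$. (Here $[x,g]\in V$ for $x\in V$, $g\in\mathfrak{h}^G$.) It is a subgroup of the semidirect product $\mathrm{GL}_k(V)\rtimes\mathrm{Hom}_k(V,\mathfrak{h}^G)$ with multiplication $(\sigma,r)\cdot(\sigma',r')=(\sigma\circ\sigma',\ r\circ\sigma'+r')$. *)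

theory Defs
  imports "HOL-Algebra.Coset" "HOL-Analysis.Product_Vector"
begin

text \<open>
  Vector spaces are carried by a set \<open>A\<close> that is a subspace of an ambient vector space type
  (in the sense of the locale \<^locale>\<open>vector_space\<close>). Maps are only relevant on their carrier;
  whenever maps are elements of a group they are taken extensional, so that
  equality in that group is equality of maps on the carrier.
\<close>

definition linear_map_on ::
  "('k::field \<Rightarrow> 'a::ab_group_add \<Rightarrow> 'a) \<Rightarrow> ('k \<Rightarrow> 'b::ab_group_add \<Rightarrow> 'b) \<Rightarrow> 'a set \<Rightarrow> 'b set
    \<Rightarrow> ('a \<Rightarrow> 'b) \<Rightarrow> bool"
  where "linear_map_on s1 s2 A B f \<longleftrightarrow>
    f \<in> A \<rightarrow> B \<and>
    (\<forall>x\<in>A. \<forall>y\<in>A. f (x + y) = f x + f y) \<and>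
    (\<forall>c. \<forall>x\<in>A. f (s1 c x) = s2 c (f x))"

definition bilinear_map_on ::
  "('k::field \<Rightarrow> 'a::ab_group_add \<Rightarrow> 'a) \<Rightarrow> ('k \<Rightarrow> 'b::ab_group_add \<Rightarrow> 'b)
    \<Rightarrow> ('k \<Rightarrow> 'c::ab_group_add \<Rightarrow> 'c) \<Rightarrow> 'a set \<Rightarrow> 'b set \<Rightarrow> 'c set \<Rightarrow> ('a \<Rightarrow> 'b \<Rightarrow> 'c) \<Rightarrow> bool"
  where "bilinear_map_on s1 s2 s3 A B C f \<longleftrightarrow>
    (\<forall>x\<in>A. linear_map_on s2 s3 B C (f x)) \<and>
    (\<forall>y\<in>B. linear_map_on s1 s3 A C (\<lambda>x. f x y))"

locale lie_algebra = vector_space smul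
  for smul :: "'k::field \<Rightarrow> 'a::ab_group_add \<Rightarrow> 'a" +
  fixes L :: "'a set" and br :: "'a \<Rightarrow> 'a \<Rightarrow> 'a"
  assumes carrier_subspace: "subspace L"
    and bracket_bilinear: "bilinear_map_on smul smul smul L L L br"
    and bracket_alternating: "x \<in> L \<Longrightarrow> br x x = 0"
    and jacobi: "\<lbrakk>x \<in> L; y \<in> L; z \<in> L\<rbrakk> \<Longrightarrow> br x (br y z) + br y (br z x) + br z (br x y) = 0"

definition lie_iso ::
  "('k::field \<Rightarrow> 'a::ab_group_add \<Rightarrow> 'a) \<Rightarrow> 'a set \<Rightarrow> ('a \<Rightarrow> 'a \<Rightarrow> 'a)
    \<Rightarrow> ('k \<Rightarrow> 'b::ab_group_add \<Rightarrow> 'b) \<Rightarrow> 'b set \<Rightarrow> ('b \<Rightarrow> 'b \<Rightarrow> 'b) \<Rightarrow> ('a \<Rightarrow> 'b) \<Rightarrow> bool"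
  where "lie_iso s1 L1 br1 s2 L2 br2 f \<longleftrightarrow>
    linear_map_on s1 s2 L1 L2 f \<and>
    (\<forall>x\<in>L1. \<forall>y\<in>L1. f (br1 x y) = br2 (f x) (f y)) \<and>
    bij_betw f L1 L2"

definition lie_aut_group ::
  "('k::field \<Rightarrow> 'a::ab_group_add \<Rightarrow> 'a) \<Rightarrow> 'a set \<Rightarrow> ('a \<Rightarrow> 'a \<Rightarrow> 'a) \<Rightarrow> ('a \<Rightarrow> 'a) monoid"
  where "lie_aut_group smul L br =
    \<lparr>carrier = {f \<in> extensional L. lie_iso smul L br smul L br f},
     mult = compose L, one = (\<lambda>x\<in>L. x)\<rparr>"

definition lie_gal_group ::
  "('k::field \<Rightarrow> 'a::ab_group_add \<Rightarrow> 'a) \<Rightarrow> 'a set \<Rightarrow> ('a \<Rightarrow> 'a \<Rightarrow> 'a) \<Rightarrow> 'a set \<Rightarrow> ('a \<Rightarrow> 'a) monoid"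
  where "lie_gal_group smul L br S =
    (lie_aut_group smul L br)
      \<lparr>carrier := {f \<in> carrier (lie_aut_group smul L br). \<forall>s\<in>S. f s = s}\<rparr>"


subsection \<open>Skew crossed products\<close>

locale skew_crossed_system =
  lie_algebra sg \<gg> br + vs: vector_space sV
  for sg :: "'k::field \<Rightarrow> 'a::ab_group_add \<Rightarrow> 'a" and \<gg> :: "'a set" and br :: "'a \<Rightarrow> 'a \<Rightarrow> 'a"
    and sV :: "'k \<Rightarrow> 'v::ab_group_add \<Rightarrow> 'v" +
  fixes V :: "'v set"
    and ract :: "'v \<Rightarrow> 'a \<Rightarrow> 'v"
    and \<theta> :: "'v \<Rightarrow> 'v \<Rightarrow> 'a"
    and curly :: "'v \<Rightarrow> 'v \<Rightarrow> 'v"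
  assumes V_subspace: "vs.subspace V"
    and ract_bilinear: "bilinear_map_on sV sg sV V \<gg> V ract"
    and theta_bilinear: "bilinear_map_on sV sV sg V V \<gg> \<theta>"
    and curly_bilinear: "bilinear_map_on sV sV sV V V V curly"
    and T1_module: "\<lbrakk>a \<in> \<gg>; b \<in> \<gg>; x \<in> V\<rbrakk>
      \<Longrightarrow> ract x (br a b) = ract (ract x a) b - ract (ract x b) a"
    and T1_theta: "x \<in> V \<Longrightarrow> \<theta> x x = 0"
    and T1_curly: "x \<in> V \<Longrightarrow> curly x x = 0"
    and T2: "\<lbrakk>a \<in> \<gg>; x \<in> V; y \<in> V\<rbrakk>
      \<Longrightarrow> ract (curly x y) a = curly x (ract y a) + curly (ract x a) y"
    and T3: "\<lbrakk>a \<in> \<gg>; x \<in> V; y \<in> V\<rbrakk>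
      \<Longrightarrow> br (\<theta> x y) a = \<theta> x (ract y a) + \<theta> (ract x a) y"
    and T4: "\<lbrakk>x \<in> V; y \<in> V; z \<in> V\<rbrakk>
      \<Longrightarrow> \<theta> x (curly y z) + \<theta> y (curly z x) + \<theta> z (curly x y) = 0"
    and T5: "\<lbrakk>x \<in> V; y \<in> V; z \<in> V\<rbrakk>
      \<Longrightarrow> (curly x (curly y z) + curly y (curly z x) + curly z (curly x y))
          + (ract x (\<theta> y z) + ract y (\<theta> z x) + ract z (\<theta> x y)) = 0"

text \<open>The underlying vector space is \<open>\<gg> \<times> V\<close> with the scaling \<^const>\<open>module_prod.scale\<close>.\<close>

definition skew_crossed_bracket ::
  "('a::ab_group_add \<Rightarrow> 'a \<Rightarrow> 'a) \<Rightarrow> ('v::ab_group_add \<Rightarrow> 'a \<Rightarrow> 'v) \<Rightarrow> ('v \<Rightarrow> 'v \<Rightarrow> 'a)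
    \<Rightarrow> ('v \<Rightarrow> 'v \<Rightarrow> 'v) \<Rightarrow> 'a \<times> 'v \<Rightarrow> 'a \<times> 'v \<Rightarrow> 'a \<times> 'v"
  where "skew_crossed_bracket br ract \<theta> curly =
    (\<lambda>(a, x) (b, y). (br a b + \<theta> x y, curly x y + ract x b - ract y a))"


subsection \<open>Invariants and the trace map of a finite group action\<close>

definition invariants :: "'a set \<Rightarrow> ('g, 'm) monoid_scheme \<Rightarrow> ('g \<Rightarrow> 'a \<Rightarrow> 'a) \<Rightarrow> 'a set"
  where "invariants L G \<phi> = {x \<in> L. \<forall>\<gamma>\<in>carrier G. \<phi> \<gamma> x = x}"

definition trace_map ::
  "('k::field \<Rightarrow> 'a::ab_group_add \<Rightarrow> 'a) \<Rightarrow> ('g, 'm) monoid_scheme \<Rightarrow> ('g \<Rightarrow> 'a \<Rightarrow> 'a) \<Rightarrow> 'a \<Rightarrow> 'a"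
  where "trace_map smul G \<phi> x = smul (inverse (of_nat (order G))) (\<Sum>\<gamma>\<in>carrier G. \<phi> \<gamma> x)"

definition trace_kernel ::
  "('k::field \<Rightarrow> 'a::ab_group_add \<Rightarrow> 'a) \<Rightarrow> 'a set \<Rightarrow> ('g, 'm) monoid_scheme \<Rightarrow> ('g \<Rightarrow> 'a \<Rightarrow> 'a)
    \<Rightarrow> 'a set"
  where "trace_kernel smul L G \<phi> = {x \<in> L. trace_map smul G \<phi> x = 0}"

definition trace_theta ::
  "('k::field \<Rightarrow> 'a::ab_group_add \<Rightarrow> 'a) \<Rightarrow> ('a \<Rightarrow> 'a \<Rightarrow> 'a) \<Rightarrow> ('g, 'm) monoid_scheme
    \<Rightarrow> ('g \<Rightarrow> 'a \<Rightarrow> 'a) \<Rightarrow> 'a \<Rightarrow> 'a \<Rightarrow> 'a"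
  where "trace_theta smul br G \<phi> x y =
    smul (inverse (of_nat (order G))) (\<Sum>\<gamma>\<in>carrier G. br (\<phi> \<gamma> x) (\<phi> \<gamma> y))"

definition trace_curly ::
  "('k::field \<Rightarrow> 'a::ab_group_add \<Rightarrow> 'a) \<Rightarrow> ('a \<Rightarrow> 'a \<Rightarrow> 'a) \<Rightarrow> ('g, 'm) monoid_scheme
    \<Rightarrow> ('g \<Rightarrow> 'a \<Rightarrow> 'a) \<Rightarrow> 'a \<Rightarrow> 'a \<Rightarrow> 'a"
  where "trace_curly smul br G \<phi> x y =
    br x y - smul (inverse (of_nat (order G))) (\<Sum>\<gamma>\<in>carrier G. br (\<phi> \<gamma> x) (\<phi> \<gamma> y))"


subsection \<open>The groups of pairs \<open>(\<sigma>, r)\<close>\<close>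

definition GL_on :: "('k::field \<Rightarrow> 'v::ab_group_add \<Rightarrow> 'v) \<Rightarrow> 'v set \<Rightarrow> ('v \<Rightarrow> 'v) set"
  where "GL_on s V = {\<sigma> \<in> extensional V. linear_map_on s s V V \<sigma> \<and> bij_betw \<sigma> V V}"

definition Hom_on ::
  "('k::field \<Rightarrow> 'v::ab_group_add \<Rightarrow> 'v) \<Rightarrow> ('k \<Rightarrow> 'w::ab_group_add \<Rightarrow> 'w) \<Rightarrow> 'v set \<Rightarrow> 'w set
    \<Rightarrow> ('v \<Rightarrow> 'w) set"
  where "Hom_on s1 s2 V W = {r \<in> extensional V. linear_map_on s1 s2 V W r}"

definition GL_Hom_semidirect ::
  "('k::field \<Rightarrow> 'v::ab_group_add \<Rightarrow> 'v) \<Rightarrow> ('k \<Rightarrow> 'w::ab_group_add \<Rightarrow> 'w) \<Rightarrow> 'v set \<Rightarrow> 'w set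
    \<Rightarrow> (('v \<Rightarrow> 'v) \<times> ('v \<Rightarrow> 'w)) monoid"
  where "GL_Hom_semidirect s1 s2 V W =
    \<lparr>carrier = GL_on s1 V \<times> Hom_on s1 s2 V W,
     mult = (\<lambda>(\<sigma>, r) (\<sigma>', r'). (compose V \<sigma> \<sigma>', \<lambda>x\<in>V. r (\<sigma>' x) + r' x)),
     one = (\<lambda>x\<in>V. x, \<lambda>x\<in>V. 0)\<rparr>"

definition artin_pairs ::
  "('k::field \<Rightarrow> 'a::ab_group_add \<Rightarrow> 'a) \<Rightarrow> 'a set \<Rightarrow> ('a \<Rightarrow> 'a \<Rightarrow> 'a) \<Rightarrow> ('g, 'm) monoid_scheme
    \<Rightarrow> ('g \<Rightarrow> 'a \<Rightarrow> 'a) \<Rightarrow> (('a \<Rightarrow> 'a) \<times> ('a \<Rightarrow> 'a)) set"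
  where "artin_pairs smul L br G \<phi> =
    (let \<gg> = invariants L G \<phi>;
         V = trace_kernel smul L G \<phi>;
         \<theta> = trace_theta smul br G \<phi>;
         curly = trace_curly smul br G \<phi>
     in {(\<sigma>, r) \<in> GL_on smul V \<times> Hom_on smul smul V \<gg>.
          (\<forall>g\<in>\<gg>. \<forall>x\<in>V. \<sigma> (br x g) = br (\<sigma> x) g) \<and>
          (\<forall>g\<in>\<gg>. \<forall>x\<in>V. r (br x g) = br (r x) g) \<and>
          (\<forall>x\<in>V. \<forall>y\<in>V.
            \<sigma> (curly x y) = curly (\<sigma> x) (\<sigma> y) + br (\<sigma> x) (r y) + br (r x) (\<sigma> y)) \<and>
          (\<forall>x\<in>V. \<forall>y\<in>V.
            r (curly x y) = br (r x) (r y) + \<theta> (\<sigma> x) (\<sigma> y) - \<theta> x y)})"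

definition artin_group ::
  "('k::field \<Rightarrow> 'a::ab_group_add \<Rightarrow> 'a) \<Rightarrow> 'a set \<Rightarrow> ('a \<Rightarrow> 'a \<Rightarrow> 'a) \<Rightarrow> ('g, 'm) monoid_scheme
    \<Rightarrow> ('g \<Rightarrow> 'a \<Rightarrow> 'a) \<Rightarrow> (('a \<Rightarrow> 'a) \<times> ('a \<Rightarrow> 'a)) monoid"
  where "artin_group smul L br G \<phi> =
    (GL_Hom_semidirect smul smul (trace_kernel smul L G \<phi>) (invariants L G \<phi>))
      \<lparr>carrier := artin_pairs smul L br G \<phi>\<rparr>"

text \<open>
  The description uses that every \<open>y \<in> L\<close> is uniquely of the form \<open>g + x\<close> with \<open>g \<in> \<gg>\<close> and
  \<open>x \<in> V\<close>.
\<close>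

definition artin_Omega ::
  "'a::ab_group_add set \<Rightarrow> 'a set \<Rightarrow> 'a set \<Rightarrow> ('a \<Rightarrow> 'a) \<times> ('a \<Rightarrow> 'a) \<Rightarrow> 'a \<Rightarrow> 'a"
  where "artin_Omega L \<gg> V =
    (\<lambda>(\<sigma>, r). \<lambda>y\<in>L. THE z. \<exists>g\<in>\<gg>. \<exists>x\<in>V. y = g + x \<and> z = g + r x + \<sigma> x)"

end

theory Submission
  imports Defs
begin

text \<open>
  The trace map \<open>t\<close> is a linear projection of \<open>L\<close> onto the invariants with \<open>t [x, a] = [t x, a]\<close> for
  invariant \<open>a\<close>, and \<open>\<theta>(x, y) = t [x, y]\<close>; nothing else about the group action is used. The identities
  (T1)-(T5) are the two components, along \<open>L = \<gg> \<oplus> V\<close>, of the Leibniz and Jacobi identities of \<open>L\<close>,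
  and the skew crossed product is a Lie algebra because its bracket is that of \<open>L\<close> transported along
  \<open>(a, x) \<mapsto> a + x\<close>. Likewise \<open>\<Omega>\<close> is an injective homomorphism from the whole semidirect product to
  the linear automorphisms of \<open>L\<close>, and the four conditions on \<open>(\<sigma>, r)\<close> say precisely that \<open>\<Omega>(\<sigma>, r)\<close>
  respects the bracket. So the pairs form the preimage of the Galois group, hence a subgroup.
\<close>

section \<open>Linear and bilinear maps between carrier sets\<close>

lemma linear_map_onD:
  assumes "linear_map_on s1 s2 A B f"
  shows linear_map_on_mem: "x \<in> A \<Longrightarrow> f x \<in> B"
    and linear_map_on_add: "x \<in> A \<Longrightarrow> y \<in> A \<Longrightarrow> f (x + y) = f x + f y"
    and linear_map_on_scale: "x \<in> A \<Longrightarrow> f (s1 c x) = s2 c (f x)"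
  using assms unfolding linear_map_on_def by auto

lemma linear_map_onI:
  assumes "\<And>x. x \<in> A \<Longrightarrow> f x \<in> B"
    and "\<And>x y. x \<in> A \<Longrightarrow> y \<in> A \<Longrightarrow> f (x + y) = f x + f y"
    and "\<And>c x. x \<in> A \<Longrightarrow> f (s1 c x) = s2 c (f x)"
  shows "linear_map_on s1 s2 A B f"
  using assms unfolding linear_map_on_def by auto

lemma linear_map_on_zero:
  assumes "linear_map_on s1 s2 A B f" "0 \<in> A"
  shows "f 0 = 0"
  using linear_map_on_add[OF assms(1) assms(2) assms(2)] by simp

text \<open>The memberships are asked of \<open>y\<close> and \<open>x - y\<close> because
  additivity is applied to the sum \<open>(x - y) + y\<close>.\<close>

lemma linear_map_on_diff:
  assumes "linear_map_on s1 s2 A B f" "y \<in> A" "x - y \<in> A"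
  shows "f (x - y) = f x - f y"
  using linear_map_on_add[OF assms(1) assms(3) assms(2)] by (simp add: algebra_simps)

lemma (in vector_space) linear_map_on_sum:
  assumes f: "linear_map_on scale s2 A B f" and A: "subspace A" and mem: "\<And>i. i \<in> I \<Longrightarrow> g i \<in> A"
  shows "f (\<Sum>i\<in>I. g i) = (\<Sum>i\<in>I. f (g i))"
  using mem
\<comment> \<open>For infinite \<open>I\<close> both sums are 0 by convention, so that case reduces
  to \<open>f 0 = 0\<close>, like the empty one.\<close>
proof (induction I rule: infinite_finite_induct)
  case (insert i I)
  then show ?case
    by (simp add: linear_map_on_add[OF f] subspace_sum[OF A])
qed (simp_all add: linear_map_on_zero[OF f subspace_0[OF A]])

lemma bilinear_map_onD:
  assumes "bilinear_map_on s1 s2 s3 A B C f"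
  shows bilinear_map_on_right: "x \<in> A \<Longrightarrow> linear_map_on s2 s3 B C (f x)"
    and bilinear_map_on_left: "y \<in> B \<Longrightarrow> linear_map_on s1 s3 A C (\<lambda>x. f x y)"
  using assms unfolding bilinear_map_on_def by auto

lemma bilinear_map_onI:
  assumes "\<And>x y. x \<in> A \<Longrightarrow> y \<in> B \<Longrightarrow> f x y \<in> C"
    and "\<And>x y y'. x \<in> A \<Longrightarrow> y \<in> B \<Longrightarrow> y' \<in> B \<Longrightarrow> f x (y + y') = f x y + f x y'"
    and "\<And>x y c. x \<in> A \<Longrightarrow> y \<in> B \<Longrightarrow> f x (s2 c y) = s3 c (f x y)"
    and "\<And>x x' y. x \<in> A \<Longrightarrow> x' \<in> A \<Longrightarrow> y \<in> B \<Longrightarrow> f (x + x') y = f x y + f x' y"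
    and "\<And>x y c. x \<in> A \<Longrightarrow> y \<in> B \<Longrightarrow> f (s1 c x) y = s3 c (f x y)"
  shows "bilinear_map_on s1 s2 s3 A B C f"
  using assms unfolding bilinear_map_on_def by (auto intro!: linear_map_onI)

lemma linear_map_on_compose:
  assumes f: "linear_map_on s2 s3 B C f" and g: "linear_map_on s1 s2 A B g"
  assumes A: "\<And>x y. x \<in> A \<Longrightarrow> y \<in> A \<Longrightarrow> x + y \<in> A" "\<And>c x. x \<in> A \<Longrightarrow> s1 c x \<in> A"
  shows "linear_map_on s1 s3 A C (compose A f g)"
  by (rule linear_map_onI)
    (auto simp: compose_def A linear_map_onD[OF f] linear_map_onD[OF g])

lemma linear_map_on_inv_into:
  assumes f: "linear_map_on s1 s2 A B f" and bij: "bij_betw f A B"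
  assumes A: "\<And>x y. x \<in> A \<Longrightarrow> y \<in> A \<Longrightarrow> x + y \<in> A" "\<And>c x. x \<in> A \<Longrightarrow> s1 c x \<in> A"
  shows "linear_map_on s2 s1 B A (inv_into A f)"
proof (rule linear_map_onI)
  note inv = bij_betw_imp_surj_on[OF bij, symmetric] and inj = bij_betw_imp_inj_on[OF bij]
  fix x assume x: "x \<in> B"
  show mem: "inv_into A f x \<in> A"
    using x inv inv_into_into by metis
  note fx = bij_betw_inv_into_right[OF bij x]
  show "inv_into A f (s2 c x) = s1 c (inv_into A f x)" for c
    using inv_into_f_f[OF inj A(2)[OF mem, of c]] linear_map_on_scale[OF f mem] fx by simp
  fix y assume y: "y \<in> B"
  have mem': "inv_into A f y \<in> A"
    using y inv inv_into_into by metis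
  show "inv_into A f (x + y) = inv_into A f x + inv_into A f y"
    using inv_into_f_f[OF inj A(1)[OF mem mem']] linear_map_on_add[OF f mem mem'] fx
      bij_betw_inv_into_right[OF bij y] by simp
qed

section \<open>Linear automorphisms of a subspace and the semidirect product with Hom\<close>

definition GL_group ::
  "('k::field \<Rightarrow> 'v::ab_group_add \<Rightarrow> 'v) \<Rightarrow> 'v set \<Rightarrow> ('v \<Rightarrow> 'v) monoid"
  where "GL_group s V = \<lparr>carrier = GL_on s V, mult = compose V, one = (\<lambda>x\<in>V. x)\<rparr>"

context vector_space
begin

lemma GL_on_compose:
  assumes "subspace V" "f \<in> GL_on scale V" "g \<in> GL_on scale V"
  shows "compose V f g \<in> GL_on scale V"
  using assms unfolding GL_on_def
  by (auto intro!: linear_map_on_compose bij_betw_compose[where B = V] subspace_add subspace_scale)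

lemma GL_on_id: "subspace V \<Longrightarrow> (\<lambda>x\<in>V. x) \<in> GL_on scale V"
  unfolding GL_on_def
  by (auto intro!: linear_map_onI simp: subspace_add subspace_scale bij_betw_def inj_on_def)

lemma GL_on_inv:
  assumes V: "subspace V" and f: "f \<in> GL_on scale V"
  shows "restrict (inv_into V f) V \<in> GL_on scale V"
proof -
  have lin: "linear_map_on scale scale V V f" and bij: "bij_betw f V V"
    using f unfolding GL_on_def by auto
  have "linear_map_on scale scale V V (inv_into V f)"
    by (rule linear_map_on_inv_into[OF lin bij]) (auto simp: V subspace_add subspace_scale)
  then have "linear_map_on scale scale V V (restrict (inv_into V f) V)"
    by (auto simp: linear_map_on_def subspace_add[OF V] subspace_scale[OF V])
  moreover have "bij_betw (restrict (inv_into V f) V) V V"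
    using bij_betw_inv_into[OF bij] by (simp cong: bij_betw_cong)
  ultimately show ?thesis
    unfolding GL_on_def by auto
qed

lemma group_GL_group:
  assumes V: "subspace V"
  shows "group (GL_group scale V)"
proof (rule groupI)
  fix f g h
  assume f: "f \<in> carrier (GL_group scale V)"
  then have f': "f \<in> extensional V" "bij_betw f V V"
    unfolding GL_group_def GL_on_def by auto
  then show "\<one>\<^bsub>GL_group scale V\<^esub> \<otimes>\<^bsub>GL_group scale V\<^esub> f = f"
    unfolding GL_group_def
    by (auto simp: fun_eq_iff compose_def extensional_def bij_betw_def)
  have "compose V (restrict (inv_into V f) V) f = (\<lambda>x\<in>V. x)"
    using f' by (auto simp: fun_eq_iff compose_def bij_betw_def)
  then show "\<exists>g\<in>carrier (GL_group scale V). g \<otimes>\<^bsub>GL_group scale V\<^esub> f = \<one>\<^bsub>GL_group scale V\<^esub>"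
    using GL_on_inv[OF V] f unfolding GL_group_def by auto
  assume g: "g \<in> carrier (GL_group scale V)"
  then show "f \<otimes>\<^bsub>GL_group scale V\<^esub> g \<in> carrier (GL_group scale V)"
    using f GL_on_compose[OF V] unfolding GL_group_def by auto
  assume h: "h \<in> carrier (GL_group scale V)"
  \<comment> \<open>\<open>compose V f g\<close> is undefined outside \<open>V\<close>, so
    associativity needs the innermost map to stay inside \<open>V\<close>.\<close>
  then have "h \<in> V \<rightarrow> V"
    unfolding GL_group_def GL_on_def bij_betw_def by auto
  then show "f \<otimes>\<^bsub>GL_group scale V\<^esub> g \<otimes>\<^bsub>GL_group scale V\<^esub> h
      = f \<otimes>\<^bsub>GL_group scale V\<^esub> (g \<otimes>\<^bsub>GL_group scale V\<^esub> h)"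
    unfolding GL_group_def by (auto simp: fun_eq_iff compose_def)
qed (auto simp: GL_group_def GL_on_id V)

text \<open>Makes the abstract inverse computable pointwise, as needed to see that Lie automorphisms
  are closed under inverses.\<close>

lemma inv_GL_group:
  assumes V: "subspace V" and f: "f \<in> GL_on scale V"
  shows "inv\<^bsub>GL_group scale V\<^esub> f = restrict (inv_into V f) V"
proof -
  interpret GL: group "GL_group scale V"
    by (rule group_GL_group[OF V])
  have "compose V (restrict (inv_into V f) V) f = (\<lambda>x\<in>V. x)"
    using f by (auto simp: fun_eq_iff compose_def bij_betw_def GL_on_def)
  then show ?thesis
    using GL.inv_equality[of "restrict (inv_into V f) V" f] f GL_on_inv[OF V f]
    by (simp add: GL_group_def)
qed

text \<open>The pair \<open>(\<sigma>, r)\<close> encodes the block triangular map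
  \<open>w + x\<close> to \<open>w + r x + \<sigma> x\<close>, and the multiplication is that of
  such matrices.\<close>

lemma group_GL_Hom_semidirect:
  assumes V: "subspace V" and W: "vector_space sW" "module.subspace sW W"
  shows "group (GL_Hom_semidirect scale sW V W)"
proof (rule groupI)
  interpret W: vector_space sW by fact
  note sub = subspace_add[OF V] subspace_scale[OF V]
    W.subspace_add[OF W(2)] W.subspace_scale[OF W(2)] W.subspace_neg[OF W(2)]
  let ?S = "GL_Hom_semidirect scale sW V W"
  show "\<one>\<^bsub>?S\<^esub> \<in> carrier ?S"
    unfolding GL_Hom_semidirect_def Hom_on_def
    by (auto simp: GL_on_id V sub W.subspace_0[OF W(2)] intro!: linear_map_onI)
  fix p q u assume p: "p \<in> carrier ?S"
  obtain \<sigma> r where p_eq: "p = (\<sigma>, r)" by (cases p)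
  have \<sigma>: "\<sigma> \<in> GL_on scale V" "\<sigma> \<in> extensional V" "bij_betw \<sigma> V V"
    and r: "r \<in> extensional V" "linear_map_on scale sW V W r"
    and \<sigma>_lin: "linear_map_on scale scale V V \<sigma>"
    using p unfolding p_eq GL_Hom_semidirect_def GL_on_def Hom_on_def by auto
  show "\<one>\<^bsub>?S\<^esub> \<otimes>\<^bsub>?S\<^esub> p = p"
    using \<sigma> r unfolding p_eq GL_Hom_semidirect_def
    by (auto simp: fun_eq_iff compose_def extensional_def bij_betw_def)
  let ?i = "restrict (inv_into V \<sigma>) V"
  have i: "?i \<in> GL_on scale V"
    by (rule GL_on_inv[OF V \<sigma>(1)])
  note i_lin = linear_map_on_inv_into[OF \<sigma>_lin \<sigma>(3) sub(1,2)]
  \<comment> \<open>The second component \<open>s\<close> of a left inverse has to satisfy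
    \<open>s (\<sigma> x) + r x = 0\<close>, which forces this formula.\<close>
  have "(\<lambda>x\<in>V. - r (inv_into V \<sigma> x)) \<in> Hom_on scale sW V W"
    unfolding Hom_on_def
    by (auto intro!: linear_map_onI simp: linear_map_onD[OF i_lin] linear_map_onD[OF r(2)] sub)
  moreover have "\<sigma> x \<in> V" "inv_into V \<sigma> (\<sigma> x) = x" if "x \<in> V" for x
    using that \<sigma>(3) by (auto simp: bij_betw_def)
  ultimately show "\<exists>q\<in>carrier ?S. q \<otimes>\<^bsub>?S\<^esub> p = \<one>\<^bsub>?S\<^esub>"
    using i unfolding p_eq GL_Hom_semidirect_def
    by (intro bexI[of _ "(?i, \<lambda>x\<in>V. - r (inv_into V \<sigma> x))"]) (auto simp: fun_eq_iff compose_def)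
  assume q: "q \<in> carrier ?S"
  obtain \<sigma>' r' where q_eq: "q = (\<sigma>', r')" by (cases q)
  have \<sigma>': "\<sigma>' \<in> GL_on scale V" "linear_map_on scale scale V V \<sigma>'"
    and r': "linear_map_on scale sW V W r'"
    using q unfolding q_eq GL_Hom_semidirect_def GL_on_def Hom_on_def by auto
  show "p \<otimes>\<^bsub>?S\<^esub> q \<in> carrier ?S"
    unfolding p_eq q_eq GL_Hom_semidirect_def Hom_on_def
    by (auto simp: GL_on_compose[OF V] \<sigma> \<sigma>' linear_map_onD[OF \<sigma>'(2)] linear_map_onD[OF r(2)]
        linear_map_onD[OF r'] sub W.scale_right_distrib intro!: linear_map_onI)
  assume u: "u \<in> carrier ?S"
  obtain \<sigma>'' r'' where u_eq: "u = (\<sigma>'', r'')" by (cases u)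
  have "\<sigma>'' \<in> V \<rightarrow> V"
    using u unfolding u_eq GL_Hom_semidirect_def GL_on_def bij_betw_def by auto
  then show "p \<otimes>\<^bsub>?S\<^esub> q \<otimes>\<^bsub>?S\<^esub> u = p \<otimes>\<^bsub>?S\<^esub> (q \<otimes>\<^bsub>?S\<^esub> u)"
    unfolding p_eq q_eq u_eq GL_Hom_semidirect_def
    by (auto simp: fun_eq_iff compose_def add.assoc)
qed

end

text \<open>Applied to \<open>\<Omega>\<close>, this yields the subgroup property of the pairs
  without testing their four conditions on products and inverses.\<close>

lemma (in group_hom) subgroup_vimage:
  assumes "subgroup K H"
  shows "subgroup {x \<in> carrier G. h x \<in> K} G"
proof -
  interpret K: subgroup K H by fact
  show ?thesis
    by (rule G.subgroupI) (auto intro: exI[of _ "\<one>\<^bsub>G\<^esub>"])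
qed

section \<open>Bracket identities, automorphism and Galois groups, transport of Lie
  structure\<close>

context lie_algebra
begin

lemmas L_closed =
  subspace_0[OF carrier_subspace] subspace_add[OF carrier_subspace]
  subspace_diff[OF carrier_subspace] subspace_neg[OF carrier_subspace]
  subspace_scale[OF carrier_subspace] subspace_sum[OF carrier_subspace]

lemmas br_right = bilinear_map_on_right[OF bracket_bilinear]
  and br_left = bilinear_map_on_left[OF bracket_bilinear]

lemma br_closed: "x \<in> L \<Longrightarrow> y \<in> L \<Longrightarrow> br x y \<in> L"
  by (rule linear_map_on_mem[OF br_right])

lemmas br_simps = br_closed
  linear_map_on_add[OF br_right] linear_map_on_add[OF br_left]
  linear_map_on_scale[OF br_right] linear_map_on_scale[OF br_left]

lemma br_diff_right: "x \<in> L \<Longrightarrow> y \<in> L \<Longrightarrow> z \<in> L \<Longrightarrow> br x (y - z) = br x y - br x z"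
  by (rule linear_map_on_diff[OF br_right]) (auto simp: L_closed)

lemma br_diff_left: "x \<in> L \<Longrightarrow> y \<in> L \<Longrightarrow> z \<in> L \<Longrightarrow> br (x - y) z = br x z - br y z"
  by (rule linear_map_on_diff[OF br_left, where x = x and y = y]) (auto simp: L_closed)

lemma br_zero_left: "x \<in> L \<Longrightarrow> br 0 x = 0"
  using br_diff_left[of 0 0 x] L_closed by simp

lemma br_zero_right: "x \<in> L \<Longrightarrow> br x 0 = 0"
  using br_diff_right[of x 0 0] L_closed by simp

lemma br_minus_right: "x \<in> L \<Longrightarrow> y \<in> L \<Longrightarrow> br x (- y) = - br x y"
  using br_diff_right[of x 0 y] L_closed by (simp add: br_zero_right)

text \<open>Polarisation: expand \<open>br (x + y) (x + y) = 0\<close>.\<close>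

lemma br_anticomm:
  assumes "x \<in> L" "y \<in> L"
  shows "br x y = - br y x"
  using bracket_alternating[of "x + y"] bracket_alternating[of x] bracket_alternating[of y] assms
  by (simp add: br_simps L_closed eq_neg_iff_add_eq_0 add.commute)

text \<open>The Jacobi identity with outer brackets moved to the right by anticommutativity. It is
  the module law in (T1), and read with other arguments it is the Leibniz rule behind (T2) and
  (T3).\<close>

lemma br_leibniz_right:
  assumes "x \<in> L" "a \<in> L" "b \<in> L"
  shows "br x (br a b) = br (br x a) b - br (br x b) a"
proof -
  have "br a (br b x) = br (br x b) a"
    using br_anticomm[of b x] br_anticomm[of a "br x b"] assms
    by (simp add: br_closed br_minus_right)
  moreover have "br b (br x a) = - br (br x a) b"
    using assms by (intro br_anticomm) (auto simp: br_closed)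
  ultimately show ?thesis
    using jacobi[OF assms] by (simp add: eq_diff_eq algebra_simps)
qed

text \<open>In this form the automorphism group differs from \<open>GL_group\<close> only in its
  carrier, so it inherits the group laws once that carrier is known to be a subgroup.\<close>

lemma lie_aut_group_eq:
  "lie_aut_group smul L br = GL_group smul L
    \<lparr>carrier := {f \<in> GL_on smul L. \<forall>x\<in>L. \<forall>y\<in>L. f (br x y) = br (f x) (f y)}\<rparr>"
  unfolding lie_aut_group_def lie_iso_def GL_group_def GL_on_def by auto

lemma subgroup_lie_aut: "subgroup (carrier (lie_aut_group smul L br)) (GL_group smul L)"
proof -
  interpret GL: group "GL_group smul L"
    by (rule group_GL_group[OF carrier_subspace])
  show ?thesis
  proof (rule GL.subgroupI)
    have "(\<lambda>x\<in>L. x) \<in> carrier (lie_aut_group smul L br)"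
      using GL_on_id[OF carrier_subspace] by (auto simp: lie_aut_group_eq br_closed)
    then show "carrier (lie_aut_group smul L br) \<noteq> {}" by auto
    fix f assume "f \<in> carrier (lie_aut_group smul L br)"
    then have f: "f \<in> GL_on smul L" "bij_betw f L L" "\<And>x. x \<in> L \<Longrightarrow> f x \<in> L"
      and hom: "\<And>x y. x \<in> L \<Longrightarrow> y \<in> L \<Longrightarrow> f (br x y) = br (f x) (f y)"
      by (auto simp: lie_aut_group_eq GL_on_def bij_betw_def)
    let ?i = "inv_into L f"
    have i: "?i x \<in> L" "f (?i x) = x" if "x \<in> L" for x
      using that f(2) by (metis bij_betw_def inv_into_into, metis bij_betw_inv_into_right)
    \<comment> \<open>\<open>f\<close> sends \<open>br (?i x) (?i y)\<close> to
      \<open>br x y\<close>, so injectivity identifies that element with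
      \<open>?i (br x y)\<close>.\<close>
    have "?i (br x y) = br (?i x) (?i y)" if "x \<in> L" "y \<in> L" for x y
      using inv_into_f_f[of f L "br (?i x) (?i y)"] hom[of "?i x" "?i y"] i that f(2)
      by (simp add: bij_betw_def br_closed)
    then show "inv\<^bsub>GL_group smul L\<^esub> f \<in> carrier (lie_aut_group smul L br)"
      by (auto simp: inv_GL_group[OF carrier_subspace f(1)] lie_aut_group_eq br_closed
          GL_on_inv[OF carrier_subspace f(1)])
    fix g assume "g \<in> carrier (lie_aut_group smul L br)"
    then have "g \<in> GL_on smul L" "\<And>x. x \<in> L \<Longrightarrow> g x \<in> L"
      "\<And>x y. x \<in> L \<Longrightarrow> y \<in> L \<Longrightarrow> g (br x y) = br (g x) (g y)"
      by (auto simp: lie_aut_group_eq GL_on_def bij_betw_def)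
    then show "f \<otimes>\<^bsub>GL_group smul L\<^esub> g \<in> carrier (lie_aut_group smul L br)"
      using f hom GL_on_compose[OF carrier_subspace f(1)]
      by (simp add: lie_aut_group_eq GL_group_def br_closed compose_def)
  qed (auto simp: lie_aut_group_eq GL_group_def)
qed

lemma group_lie_aut_group: "group (lie_aut_group smul L br)"
  using subgroup.subgroup_is_group[OF subgroup_lie_aut group_GL_group[OF carrier_subspace]]
  by (simp add: lie_aut_group_eq)

lemma subgroup_lie_gal:
  assumes "S \<subseteq> L"
  shows "subgroup (carrier (lie_gal_group smul L br S)) (lie_aut_group smul L br)"
proof -
  let ?A = "lie_aut_group smul L br"
  interpret A: group ?A
    by (rule group_lie_aut_group)
  have one: "\<one>\<^bsub>?A\<^esub> = (\<lambda>x\<in>L. x)" and mult: "f \<otimes>\<^bsub>?A\<^esub> g = compose L f g" for f g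
    by (auto simp: lie_aut_group_def)
  have carrier: "carrier (lie_gal_group smul L br S) = {f \<in> carrier ?A. \<forall>s\<in>S. f s = s}"
    by (simp add: lie_gal_group_def)
  show ?thesis
    unfolding carrier
  proof (rule A.subgroupI)
    show "{f \<in> carrier ?A. \<forall>s\<in>S. f s = s} \<noteq> {}"
      using A.one_closed assms one by (auto intro!: exI[of _ "\<one>\<^bsub>?A\<^esub>"])
    fix f assume f: "f \<in> {f \<in> carrier ?A. \<forall>s\<in>S. f s = s}"
    \<comment> \<open>Evaluate the left inverse law at \<open>s\<close>, where
      \<open>f s = s\<close>.\<close>
    have "(inv\<^bsub>?A\<^esub> f) s = s" if s: "s \<in> S" for s
    proof -
      have "compose L (inv\<^bsub>?A\<^esub> f) f s = s"
        using A.l_inv[of f] f s assms by (auto simp: mult one)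
      then show ?thesis
        using f s assms by (auto simp: compose_def)
    qed
    then show "inv\<^bsub>?A\<^esub> f \<in> {f \<in> carrier ?A. \<forall>s\<in>S. f s = s}"
      using f by auto
    fix g assume g: "g \<in> {f \<in> carrier ?A. \<forall>s\<in>S. f s = s}"
    then show "f \<otimes>\<^bsub>?A\<^esub> g \<in> {f \<in> carrier ?A. \<forall>s\<in>S. f s = s}"
      using f assms A.m_closed[of f g] by (auto simp: mult compose_def)
  qed auto
qed

text \<open>As \<open>f\<close> is injective, each Lie axiom on \<open>L'\<close> may be tested
  after applying \<open>f\<close>, where it becomes the same axiom on \<open>L\<close>.\<close>

lemma lie_algebra_transfer:
  fixes s' :: "'k \<Rightarrow> 'b::ab_group_add \<Rightarrow> 'b"
  assumes vs: "vector_space s'" "module.subspace s' L'"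
    and f: "linear_map_on s' smul L' L f" "inj_on f L'"
    and br': "\<And>x y. x \<in> L' \<Longrightarrow> y \<in> L' \<Longrightarrow> br' x y \<in> L'"
      "\<And>x y. x \<in> L' \<Longrightarrow> y \<in> L' \<Longrightarrow> f (br' x y) = br (f x) (f y)"
  shows "lie_algebra s' L' br'"
proof -
  interpret L': vector_space s' by fact
  note sub = L'.subspace_0[OF vs(2)] L'.subspace_add[OF vs(2)] L'.subspace_scale[OF vs(2)]
  note simps = sub br' br_simps linear_map_onD[OF f(1)] L_closed
  have eqI: "x = y" if "f x = f y" "x \<in> L'" "y \<in> L'" for x y
    using f(2) that by (auto dest: inj_onD)
  show ?thesis
  proof (unfold_locales)
    show "bilinear_map_on s' s' s' L' L' L' br'"
      by (rule bilinear_map_onI; (rule eqI)?) (simp_all add: simps)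
    show "br' x x = 0" if "x \<in> L'" for x
      by (rule eqI) (use that in \<open>simp_all add: simps bracket_alternating linear_map_on_zero[OF f(1)]\<close>)
    show "br' x (br' y z) + br' y (br' z x) + br' z (br' x y) = 0"
      if "x \<in> L'" "y \<in> L'" "z \<in> L'" for x y z
      by (rule eqI) (use that in \<open>simp_all add: simps jacobi linear_map_on_zero[OF f(1)]\<close>)
  qed fact
qed

end

section \<open>Equivariant linear retractions onto a subalgebra and the skew crossed product\<close>

text \<open>
  The equations for \<open>\<theta>\<close> and \<open>curly\<close> are only required on \<open>L\<close>, since the action is unspecified outside \<open>L\<close>.
\<close>

locale lie_retraction = lie_algebra smul L br
  for smul :: "'k::field \<Rightarrow> 'a::ab_group_add \<Rightarrow> 'a" and L :: "'a set" and br :: "'a \<Rightarrow> 'a \<Rightarrow> 'a" +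
  fixes \<gg> :: "'a set" and t :: "'a \<Rightarrow> 'a"
    and V :: "'a set" and \<theta> :: "'a \<Rightarrow> 'a \<Rightarrow> 'a" and curly :: "'a \<Rightarrow> 'a \<Rightarrow> 'a"
  assumes gg_subset: "\<gg> \<subseteq> L"
    and gg_subspace: "subspace \<gg>"
    and gg_br: "\<lbrakk>a \<in> \<gg>; b \<in> \<gg>\<rbrakk> \<Longrightarrow> br a b \<in> \<gg>"
    and t_linear: "linear_map_on smul smul L \<gg> t"
    and t_id: "a \<in> \<gg> \<Longrightarrow> t a = a"
    and t_br: "\<lbrakk>x \<in> L; a \<in> \<gg>\<rbrakk> \<Longrightarrow> t (br x a) = br (t x) a"
    and V_eq: "V = {x \<in> L. t x = 0}"
    and theta_eq: "\<lbrakk>x \<in> L; y \<in> L\<rbrakk> \<Longrightarrow> \<theta> x y = t (br x y)"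
    and curly_eq: "\<lbrakk>x \<in> L; y \<in> L\<rbrakk> \<Longrightarrow> curly x y = br x y - t (br x y)"
begin

lemma gg_L: "a \<in> \<gg> \<Longrightarrow> a \<in> L"
  using gg_subset by auto

lemma V_L: "x \<in> V \<Longrightarrow> x \<in> L"
  and t_V: "x \<in> V \<Longrightarrow> t x = 0"
  and V_I: "x \<in> L \<Longrightarrow> t x = 0 \<Longrightarrow> x \<in> V"
  by (auto simp: V_eq)

lemmas gg_closed =
  subspace_0[OF gg_subspace] subspace_add[OF gg_subspace] subspace_diff[OF gg_subspace]
  subspace_neg[OF gg_subspace] subspace_scale[OF gg_subspace] gg_br

lemma t_diff: "x \<in> L \<Longrightarrow> y \<in> L \<Longrightarrow> t (x - y) = t x - t y"
  by (rule linear_map_on_diff[OF t_linear]) (auto simp: L_closed)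

lemmas t_zero = linear_map_on_zero[OF t_linear L_closed(1)]
lemmas t_simps = linear_map_onD[OF t_linear] t_diff t_id t_br t_V t_zero

lemma t_L: "x \<in> L \<Longrightarrow> t x \<in> L"
  by (simp add: t_simps gg_L)

lemmas retraction_simps = t_simps t_L gg_closed br_simps br_diff_left br_diff_right br_zero_left br_zero_right
  L_closed scale_right_diff_distrib scale_right_distrib
lemmas L_mems = gg_L V_L

lemma V_subspace: "subspace V"
  by (rule subspaceI) (auto intro!: V_I simp: retraction_simps L_mems)

lemmas V_closed =
  subspace_0[OF V_subspace] subspace_add[OF V_subspace] subspace_diff[OF V_subspace]
  subspace_neg[OF V_subspace] subspace_scale[OF V_subspace]

text \<open>\<open>t\<close> is the identity on \<open>\<gg>\<close>, where its values lie, hence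
  idempotent. This gives the \<open>V\<close> component of an element.\<close>

lemma diff_t_V: "x \<in> L \<Longrightarrow> x - t x \<in> V"
  by (rule V_I) (auto simp: retraction_simps)

text \<open>By equivariance \<open>t (br x a) = br (t x) a\<close>, and \<open>t x = 0\<close>. Thus
  \<open>V\<close> is stable under the right action of \<open>\<gg>\<close>.\<close>

lemma br_V: "x \<in> V \<Longrightarrow> a \<in> \<gg> \<Longrightarrow> br x a \<in> V"
  by (rule V_I) (auto simp: retraction_simps L_mems)

lemma br_V': "x \<in> V \<Longrightarrow> a \<in> \<gg> \<Longrightarrow> br a x \<in> V"
  using br_anticomm[of a x] br_V V_closed by (simp add: L_mems)

lemma theta_gg: "x \<in> L \<Longrightarrow> y \<in> L \<Longrightarrow> \<theta> x y \<in> \<gg>"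
  by (simp add: theta_eq retraction_simps)

lemma curly_V: "x \<in> L \<Longrightarrow> y \<in> L \<Longrightarrow> curly x y \<in> V"
  by (simp add: curly_eq diff_t_V br_closed)

lemma theta_add_curly: "x \<in> L \<Longrightarrow> y \<in> L \<Longrightarrow> \<theta> x y + curly x y = br x y"
  by (simp add: theta_eq curly_eq)

lemma decompose:
  assumes "y \<in> L"
  obtains a x where "a \<in> \<gg>" "x \<in> V" "y = a + x"
  using that[of "t y" "y - t y"] assms by (simp add: diff_t_V retraction_simps)

text \<open>\<open>t\<close> fixes \<open>\<gg>\<close> and kills \<open>V\<close>, so applying it
  isolates the first summand.\<close>

lemma decompose_unique:
  assumes "a + x = b + y" "a \<in> \<gg>" "b \<in> \<gg>" "x \<in> V" "y \<in> V"
  shows "a = b" and "x = y"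
proof -
  show "a = b"
    using arg_cong[OF assms(1), of t] assms(2-) by (simp add: retraction_simps L_mems)
  with assms(1) show "x = y" by simp
qed

lemma skew_crossed_system: "skew_crossed_system smul \<gg> br smul V br \<theta> curly"
proof unfold_locales
  show "bilinear_map_on smul smul smul \<gg> \<gg> \<gg> br"
    by (rule bilinear_map_onI) (simp_all add: retraction_simps L_mems)
  show "bilinear_map_on smul smul smul V \<gg> V br"
    by (rule bilinear_map_onI) (simp_all add: retraction_simps L_mems br_V)
  show "bilinear_map_on smul smul smul V V \<gg> \<theta>"
    by (rule bilinear_map_onI) (simp_all add: retraction_simps L_mems theta_eq)
  show "bilinear_map_on smul smul smul V V V curly"
    by (rule bilinear_map_onI) (simp add: curly_V L_mems, simp_all add: retraction_simps L_mems curly_eq)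
  show "br a (br b c) + br b (br c a) + br c (br a b) = 0" if "a \<in> \<gg>" "b \<in> \<gg>" "c \<in> \<gg>" for a b c
    using jacobi that gg_L by auto
  show "br x (br a b) = br (br x a) b - br (br x b) a" if "a \<in> \<gg>" "b \<in> \<gg>" "x \<in> V" for a b x
    using br_leibniz_right that L_mems by auto
  fix x y assume x: "x \<in> V" and y: "y \<in> V"
  have leibniz: "br (br x y) a = br x (br y a) + br (br x a) y" if "a \<in> \<gg>" for a
    using br_leibniz_right[of x y a] x y that by (simp add: L_mems)
  \<comment> \<open>The image of the Leibniz rule under \<open>t\<close>, with equivariance on the
    left side. This is (T3), and subtracting it from the Leibniz rule gives (T2).\<close>
  have t_leibniz: "br (t (br x y)) a = t (br x (br y a)) + t (br (br x a) y)" if a: "a \<in> \<gg>" for a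
  proof -
    have "br (t (br x y)) a = t (br (br x y) a)"
      using a x y by (simp add: t_br br_closed L_mems)
    also have "\<dots> = t (br x (br y a) + br (br x a) y)"
      by (simp only: leibniz[OF a])
    finally show ?thesis
      using a x y by (simp add: linear_map_on_add[OF t_linear] br_closed L_mems)
  qed
  show "br (curly x y) a = curly x (br y a) + curly (br x a) y" if "a \<in> \<gg>" for a
    using that x y leibniz t_leibniz by (simp add: curly_eq br_closed br_diff_left t_L L_mems)
  show "br (\<theta> x y) a = \<theta> x (br y a) + \<theta> (br x a) y" if "a \<in> \<gg>" for a
    using that x y t_leibniz by (simp add: theta_eq br_closed L_mems)
  fix z assume z: "z \<in> V"
  note xyz = x y z
  have "t (br x (br y z) + br y (br z x) + br z (br x y)) = 0"
    using xyz by (simp add: jacobi L_mems retraction_simps)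
  then have t_jacobi: "t (br x (br y z)) + t (br y (br z x)) + t (br z (br x y)) = 0"
    using xyz by (simp add: L_mems retraction_simps)
  \<comment> \<open>Expanding \<open>curly y z\<close> inside \<open>\<theta> x\<close> leaves the
    extra term \<open>t (br x (t (br y z)))\<close>, which equals
    \<open>br (t x) (t (br y z)) = 0\<close> since \<open>t x = 0\<close>.\<close>
  then show "\<theta> x (curly y z) + \<theta> y (curly z x) + \<theta> z (curly x y) = 0"
    using xyz by (simp add: theta_eq curly_eq retraction_simps L_mems)
  \<comment> \<open>The terms \<open>br x (\<theta> y z)\<close> cancel the corrections coming from
    the inner curly brackets. What remains is the Jacobi sum minus its image under
    \<open>t\<close>.\<close>
  show "(curly x (curly y z) + curly y (curly z x) + curly z (curly x y))
      + (br x (\<theta> y z) + br y (\<theta> z x) + br z (\<theta> x y)) = 0"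
    using t_jacobi jacobi[of x y z] xyz
    by (simp add: theta_eq curly_eq retraction_simps L_mems, simp flip: add_diff_add)
qed (use gg_subspace V_subspace in \<open>auto simp: L_mems theta_eq curly_eq bracket_alternating t_zero\<close>)

abbreviation "cbr \<equiv> skew_crossed_bracket br br \<theta> curly"

lemma cbr_closed: "p \<in> \<gg> \<times> V \<Longrightarrow> q \<in> \<gg> \<times> V \<Longrightarrow> cbr p q \<in> \<gg> \<times> V"
  by (auto simp: skew_crossed_bracket_def gg_closed V_closed theta_gg curly_V br_V L_mems)

lemma lie_iso_sum:
  "lie_iso (module_prod.scale smul smul) (\<gg> \<times> V) cbr smul L br (\<lambda>(a, x). a + x)"
proof -
  interpret vp: vector_space_prod smul smul
    by unfold_locales
  have "bij_betw (\<lambda>(a, x). a + x) (\<gg> \<times> V) L"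
  proof (rule bij_betw_imageI)
    show "inj_on (\<lambda>(a, x). a + x) (\<gg> \<times> V)"
      by (clarsimp simp: inj_on_def) (metis decompose_unique)
    show "(\<lambda>(a, x). a + x) ` (\<gg> \<times> V) = L"
      by (force simp: L_mems L_closed elim: decompose)
  qed
  moreover have "br (a + x) (b + y) = (br a b + \<theta> x y) + (curly x y + br x b - br y a)"
    if "a \<in> \<gg>" "b \<in> \<gg>" "x \<in> V" "y \<in> V" for a b x y
  proof -
    \<comment> \<open>The crossed bracket uses only the right action, so the left bracket with
      \<open>a\<close> is turned around. The terms \<open>\<theta> x y\<close> and
      \<open>curly x y\<close> add up to \<open>br x y\<close>.\<close>
    have "br a y = - br y a"
      using that by (intro br_anticomm) (auto simp: L_mems)
    with that show ?thesis
      by (simp add: retraction_simps L_mems theta_eq curly_eq)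
  qed
  ultimately show ?thesis
    unfolding lie_iso_def skew_crossed_bracket_def
    by (auto intro!: linear_map_onI simp: vp.scale_prod retraction_simps L_mems)
qed

lemma lie_algebra_skew_crossed:
  "lie_algebra (module_prod.scale smul smul) (\<gg> \<times> V) cbr"
proof -
  interpret vp: vector_space_prod smul smul
    by unfold_locales
  let ?f = "\<lambda>(a, x). a + x"
  note iso = lie_iso_sum[unfolded lie_iso_def bij_betw_def]
  show ?thesis
  proof (rule lie_algebra_transfer[where f = ?f])
    show "linear_map_on vp.scale smul (\<gg> \<times> V) L ?f" "inj_on ?f (\<gg> \<times> V)"
      using iso by simp_all
    show "?f (cbr p q) = br (?f p) (?f q)" if "p \<in> \<gg> \<times> V" "q \<in> \<gg> \<times> V" for p q
      by (rule bspec[OF bspec[OF conjunct1[OF conjunct2[OF iso]] that(1)] that(2)])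
  qed (use vp.p.vector_space_axioms vp.subspace_Times[OF gg_subspace V_subspace] cbr_closed in blast)+
qed

section \<open>The map \<open>\<Omega>\<close> and the group of pairs\<close>

abbreviation "SD \<equiv> GL_Hom_semidirect smul smul V \<gg>"
abbreviation "\<Omega> \<equiv> artin_Omega L \<gg> V"

text \<open>The counterpart of \<open>artin_pairs\<close> for an arbitrary retraction; inserting the
  trace data makes the two bodies coincide.\<close>

definition lie_pairs :: "(('a \<Rightarrow> 'a) \<times> ('a \<Rightarrow> 'a)) set" where
  "lie_pairs = {(\<sigma>, r) \<in> GL_on smul V \<times> Hom_on smul smul V \<gg>.
    (\<forall>g\<in>\<gg>. \<forall>x\<in>V. \<sigma> (br x g) = br (\<sigma> x) g) \<and>
    (\<forall>g\<in>\<gg>. \<forall>x\<in>V. r (br x g) = br (r x) g) \<and>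
    (\<forall>x\<in>V. \<forall>y\<in>V.
      \<sigma> (curly x y) = curly (\<sigma> x) (\<sigma> y) + br (\<sigma> x) (r y) + br (r x) (\<sigma> y)) \<and>
    (\<forall>x\<in>V. \<forall>y\<in>V.
      r (curly x y) = br (r x) (r y) + \<theta> (\<sigma> x) (\<sigma> y) - \<theta> x y)}"

lemma SD_D:
  assumes "(\<sigma>, r) \<in> carrier SD"
  shows SD_sigma: "linear_map_on smul smul V V \<sigma>" and SD_r: "linear_map_on smul smul V \<gg> r"
    and SD_bij: "bij_betw \<sigma> V V"
    and SD_ext: "\<sigma> \<in> extensional V" "r \<in> extensional V"
  using assms by (auto simp: GL_Hom_semidirect_def GL_on_def Hom_on_def)

text \<open>Uniqueness of the splitting discharges the definite description in
  \<open>artin_Omega\<close>.\<close>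

lemma Omega_apply:
  assumes "a \<in> \<gg>" "x \<in> V"
  shows "\<Omega> (\<sigma>, r) (a + x) = a + r x + \<sigma> x"
proof -
  have "(THE z. \<exists>g\<in>\<gg>. \<exists>x'\<in>V. a + x = g + x' \<and> z = g + r x' + \<sigma> x') = a + r x + \<sigma> x"
    using assms by (intro the_equality) (auto dest: decompose_unique)
  then show ?thesis
    using assms by (simp add: artin_Omega_def L_mems L_closed)
qed

lemma Omega_gg:
  assumes "(\<sigma>, r) \<in> carrier SD" "a \<in> \<gg>"
  shows "\<Omega> (\<sigma>, r) a = a"
  using Omega_apply[OF assms(2) V_closed(1), of \<sigma> r]
    linear_map_on_zero[OF SD_sigma[OF assms(1)] V_closed(1)]
    linear_map_on_zero[OF SD_r[OF assms(1)] V_closed(1)] by simp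

lemma Omega_V: "x \<in> V \<Longrightarrow> \<Omega> (\<sigma>, r) x = r x + \<sigma> x"
  using Omega_apply[OF gg_closed(1)] by simp

lemma Omega_GL:
  assumes p: "(\<sigma>, r) \<in> carrier SD"
  shows "\<Omega> (\<sigma>, r) \<in> GL_on smul L"
proof -
  note \<sigma> = linear_map_onD[OF SD_sigma[OF p]] and r = linear_map_onD[OF SD_r[OF p]]
  note S = \<sigma> r Omega_apply retraction_simps L_mems V_closed
  have lin: "linear_map_on smul smul L L (\<Omega> (\<sigma>, r))"
  proof (rule linear_map_onI)
    fix y assume "y \<in> L"
    then obtain a x where y: "a \<in> \<gg>" "x \<in> V" "y = a + x" by (rule decompose)
    then show "\<Omega> (\<sigma>, r) y \<in> L"
      by (simp add: S)
    show "\<Omega> (\<sigma>, r) (smul c y) = smul c (\<Omega> (\<sigma>, r) y)" for c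
      using y Omega_apply[of "smul c a" "smul c x"] by (simp add: S)
    fix y' assume "y' \<in> L"
    then obtain a' x' where y': "a' \<in> \<gg>" "x' \<in> V" "y' = a' + x'" by (rule decompose)
    \<comment> \<open>Regrouped into a \<open>\<gg>\<close> part and a \<open>V\<close> part, the
      sum has the shape that \<open>Omega_apply\<close> expects.\<close>
    have "y + y' = (a + a') + (x + x')"
      using y y' by simp
    then show "\<Omega> (\<sigma>, r) (y + y') = \<Omega> (\<sigma>, r) y + \<Omega> (\<sigma>, r) y'"
      using y y' Omega_apply[of "a + a'" "x + x'"] by (simp only:) (simp add: S)
  qed
  have "bij_betw (\<Omega> (\<sigma>, r)) L L"
  proof (rule bij_betw_imageI)
    show "inj_on (\<Omega> (\<sigma>, r)) L"
    proof (rule inj_onI)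
      fix y y' assume yy': "y \<in> L" "y' \<in> L" "\<Omega> (\<sigma>, r) y = \<Omega> (\<sigma>, r) y'"
      obtain a x where y: "a \<in> \<gg>" "x \<in> V" "y = a + x" using yy'(1) by (rule decompose)
      obtain a' x' where y': "a' \<in> \<gg>" "x' \<in> V" "y' = a' + x'" using yy'(2) by (rule decompose)
      have "a + r x + \<sigma> x = a' + r x' + \<sigma> x'"
        using yy'(3) y y' by (simp add: S)
      from decompose_unique[OF this] have "a + r x = a' + r x'" "\<sigma> x = \<sigma> x'"
        using y y' by (simp_all add: S)
      then show "y = y'"
        using y y' SD_bij[OF p] by (auto simp: bij_betw_def dest: inj_onD)
    qed
    have "y \<in> \<Omega> (\<sigma>, r) ` L" if "y \<in> L" for y
    proof -
      obtain a z where y: "a \<in> \<gg>" "z \<in> V" "y = a + z" using \<open>y \<in> L\<close> by (rule decompose)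
      moreover obtain x where x: "x \<in> V" "z = \<sigma> x"
        using SD_bij[OF p] y(2) by (auto simp: bij_betw_def)
      \<comment> \<open>\<open>\<Omega>\<close> adds \<open>r x\<close> to the invariant part, so
        the preimage of \<open>a + \<sigma> x\<close> must start from
        \<open>a - r x\<close>.\<close>
      ultimately show ?thesis
        by (intro image_eqI[of _ _ "(a - r x) + x"]) (simp_all add: S del: add_diff_eq diff_add_eq)
    qed
    moreover have "\<Omega> (\<sigma>, r) ` L \<subseteq> L"
      using linear_map_on_mem[OF lin] by auto
    ultimately show "\<Omega> (\<sigma>, r) ` L = L" by auto
  qed
  moreover have "\<Omega> (\<sigma>, r) \<in> extensional L"
    by (simp add: artin_Omega_def)
  ultimately show ?thesis
    using lin by (simp add: GL_on_def)
qed

lemma Omega_hom: "\<Omega> \<in> hom SD (GL_group smul L)"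
proof (rule homI)
  fix p assume "p \<in> carrier SD"
  then show "\<Omega> p \<in> carrier (GL_group smul L)"
    using Omega_GL by (cases p) (simp add: GL_group_def)
next
  fix p q assume pq: "p \<in> carrier SD" "q \<in> carrier SD"
  obtain \<sigma> r \<sigma>' r' where eq: "p = (\<sigma>, r)" "q = (\<sigma>', r')" by (cases p, cases q)
  note S = linear_map_onD[OF SD_sigma[OF pq(1)[unfolded eq]]]
    linear_map_onD[OF SD_sigma[OF pq(2)[unfolded eq]]] linear_map_onD[OF SD_r[OF pq(2)[unfolded eq]]]
  have "\<Omega> (compose V \<sigma> \<sigma>', \<lambda>x\<in>V. r (\<sigma>' x) + r' x) y = compose L (\<Omega> (\<sigma>, r)) (\<Omega> (\<sigma>', r')) y"
    if y: "y \<in> L" for y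
  proof -
    obtain a x where ax: "a \<in> \<gg>" "x \<in> V" "y = a + x" using y by (rule decompose)
    \<comment> \<open>After the first map the invariant part is \<open>a + r' x\<close> and the
      \<open>V\<close> part is \<open>\<sigma>' x\<close>. The second map therefore adds
      \<open>r (\<sigma>' x)\<close>, as in the semidirect multiplication.\<close>
    then have "\<Omega> (\<sigma>, r) (\<Omega> (\<sigma>', r') y) = \<Omega> (\<sigma>, r) ((a + r' x) + \<sigma>' x)"
      by (simp add: Omega_apply)
    also have "\<dots> = a + r' x + r (\<sigma>' x) + \<sigma> (\<sigma>' x)"
      using ax by (intro Omega_apply) (auto simp: S gg_closed)
    finally show ?thesis
      using y ax by (simp add: Omega_apply compose_def algebra_simps)
  qed
  then have "\<Omega> (compose V \<sigma> \<sigma>', \<lambda>x\<in>V. r (\<sigma>' x) + r' x) = compose L (\<Omega> (\<sigma>, r)) (\<Omega> (\<sigma>', r'))"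
    by (intro extensionalityI[of _ L]) (auto simp: artin_Omega_def compose_def)
  then show "\<Omega> (p \<otimes>\<^bsub>SD\<^esub> q) = \<Omega> p \<otimes>\<^bsub>GL_group smul L\<^esub> \<Omega> q"
    by (simp add: eq GL_Hom_semidirect_def GL_group_def)
qed

lemma group_SD: "group SD"
  by (rule group_GL_Hom_semidirect[OF V_subspace vector_space_axioms gg_subspace])

lemma inj_on_Omega: "inj_on \<Omega> (carrier SD)"
proof (rule inj_onI)
  fix p q assume pq: "p \<in> carrier SD" "q \<in> carrier SD" "\<Omega> p = \<Omega> q"
  obtain \<sigma> r \<sigma>' r' where eq: "p = (\<sigma>, r)" "q = (\<sigma>', r')" by (cases p, cases q)
  note p = pq(1)[unfolded eq] and q = pq(2)[unfolded eq]
  \<comment> \<open>On \<open>V\<close> the two components of \<open>\<Omega> p\<close> are the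
    values of \<open>r\<close> and \<open>\<sigma>\<close>, so they can be read off; extensionality
    then settles equality of the maps.\<close>
  have "r x = r' x \<and> \<sigma> x = \<sigma>' x" if x: "x \<in> V" for x
  proof -
    have "r x + \<sigma> x = r' x + \<sigma>' x"
      using Omega_V[OF x, of \<sigma> r] Omega_V[OF x, of \<sigma>' r'] pq(3) eq by simp
    then show ?thesis
      using linear_map_on_mem[OF SD_sigma[OF p] x] linear_map_on_mem[OF SD_r[OF p] x]
        linear_map_on_mem[OF SD_sigma[OF q] x] linear_map_on_mem[OF SD_r[OF q] x]
      by (auto dest: decompose_unique)
  qed
  then show "p = q"
    using SD_ext[OF p] SD_ext[OF q] by (auto simp: eq intro!: extensionalityI[of _ V])
qed

lemma mem_lie_gal_iff:
  "f \<in> carrier (lie_gal_group smul L br \<gg>) \<longleftrightarrow>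
    f \<in> GL_on smul L \<and> (\<forall>x\<in>L. \<forall>y\<in>L. f (br x y) = br (f x) (f y)) \<and> (\<forall>a\<in>\<gg>. f a = a)"
  by (auto simp: lie_gal_group_def lie_aut_group_eq)

text \<open>By bilinearity and anticommutativity, preservation of the bracket is tested on three
  kinds of arguments. On \<open>\<gg>\<close> it is automatic because \<open>\<Omega>\<close> fixes
  \<open>\<gg>\<close>. On \<open>V\<close> against \<open>\<gg>\<close>, comparing components gives
  the first two conditions on pairs, and on \<open>V\<close> against \<open>V\<close> the last
  two.\<close>

lemma lie_pairs_iff:
  assumes p: "(\<sigma>, r) \<in> carrier SD"
  shows "(\<sigma>, r) \<in> lie_pairs \<longleftrightarrow> \<Omega> (\<sigma>, r) \<in> carrier (lie_gal_group smul L br \<gg>)"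
proof -
  let ?F = "\<Omega> (\<sigma>, r)"
  note \<sigma> = linear_map_onD[OF SD_sigma[OF p]] and r = linear_map_onD[OF SD_r[OF p]]
  have F_lin: "linear_map_on smul smul L L ?F"
    using Omega_GL[OF p] by (simp add: GL_on_def)
  note F = linear_map_onD[OF F_lin] Omega_gg[OF p] Omega_V
  note mems = L_mems gg_closed V_closed \<sigma>(1) r(1) br_V br_V' theta_gg curly_V
  have F_module: "?F (br x a) = r (br x a) + \<sigma> (br x a)"
    and br_F: "br (?F x) a = br (r x) a + br (\<sigma> x) a" if "a \<in> \<gg>" "x \<in> V" for a x
    using that by (simp_all add: F mems br_simps)
  have module_iff: "?F (br x a) = br (?F x) a \<longleftrightarrow> \<sigma> (br x a) = br (\<sigma> x) a \<and> r (br x a) = br (r x) a"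
    if "a \<in> \<gg>" "x \<in> V" for a x
    using that decompose_unique[of "r (br x a)" "\<sigma> (br x a)" "br (r x) a" "br (\<sigma> x) a"]
    by (auto simp: F_module br_F mems)
  have bracket_iff: "?F (br x y) = br (?F x) (?F y) \<longleftrightarrow>
      \<sigma> (curly x y) = curly (\<sigma> x) (\<sigma> y) + br (\<sigma> x) (r y) + br (r x) (\<sigma> y) \<and>
      r (curly x y) = br (r x) (r y) + \<theta> (\<sigma> x) (\<sigma> y) - \<theta> x y"
    if xy: "x \<in> V" "y \<in> V" for x y
  proof -
    \<comment> \<open>Splitting \<open>br x y\<close> into \<open>\<theta> x y\<close> in
      \<open>\<gg>\<close> and \<open>curly x y\<close> in \<open>V\<close> makes
      \<open>Omega_apply\<close> usable.\<close>
    have "?F (br x y) = ?F (\<theta> x y + curly x y)"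
      using xy by (simp add: theta_add_curly mems)
    also have "\<dots> = (\<theta> x y + r (curly x y)) + \<sigma> (curly x y)"
      using xy by (intro Omega_apply) (simp_all add: mems)
    finally have lhs: "?F (br x y) = (\<theta> x y + r (curly x y)) + \<sigma> (curly x y)" .
    have "br (?F x) (?F y) = br (r x) (r y) + br (\<sigma> x) (\<sigma> y) + (br (\<sigma> x) (r y) + br (r x) (\<sigma> y))"
      using xy by (simp add: F mems br_simps L_closed)
    also have "br (\<sigma> x) (\<sigma> y) = \<theta> (\<sigma> x) (\<sigma> y) + curly (\<sigma> x) (\<sigma> y)"
      using xy by (simp add: theta_add_curly mems)
    finally have rhs: "br (?F x) (?F y) = (br (r x) (r y) + \<theta> (\<sigma> x) (\<sigma> y))
        + (curly (\<sigma> x) (\<sigma> y) + br (\<sigma> x) (r y) + br (r x) (\<sigma> y))"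
      by (simp add: algebra_simps)
    have "?F (br x y) = br (?F x) (?F y) \<longleftrightarrow>
        \<theta> x y + r (curly x y) = br (r x) (r y) + \<theta> (\<sigma> x) (\<sigma> y) \<and>
        \<sigma> (curly x y) = curly (\<sigma> x) (\<sigma> y) + br (\<sigma> x) (r y) + br (r x) (\<sigma> y)"
      unfolding lhs rhs using xy by (auto simp: mems dest: decompose_unique)
    then show ?thesis
      by (auto simp: algebra_simps)
  qed
  have "?F (br u v) = br (?F u) (?F v)" if pairs: "(\<sigma>, r) \<in> lie_pairs" and uv: "u \<in> L" "v \<in> L" for u v
  proof -
    obtain a x where u: "a \<in> \<gg>" "x \<in> V" "u = a + x" using uv(1) by (rule decompose)
    obtain b y where v: "b \<in> \<gg>" "y \<in> V" "v = b + y" using uv(2) by (rule decompose)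
    have module: "?F (br x a) = br (?F x) a" if "a \<in> \<gg>" "x \<in> V" for a x
      using module_iff[OF that] pairs that by (auto simp: lie_pairs_def)
    have "?F (br x y) = br (?F x) (?F y)"
      using bracket_iff u v pairs by (auto simp: lie_pairs_def)
    \<comment> \<open>The module conditions speak of invariants on the right, so the remaining mixed
      bracket is reversed on both sides.\<close>
    moreover have "?F (br a y) = br a (?F y)"
    proof -
      have "br a y = - br y a" "br a (?F y) = - br (?F y) a"
        using u v by (auto intro!: br_anticomm simp: F(1) L_mems)
      moreover have "?F (- br y a) = - ?F (br y a)"
        using linear_map_on_diff[OF F_lin, of "br y a" 0] linear_map_on_zero[OF F_lin] u v
        by (simp add: L_closed br_simps L_mems)
      ultimately show ?thesis
        using module u v by simp
    qed
    ultimately show ?thesis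
      using u v module by (simp add: F(1,2,4) mems br_simps L_closed)
  qed
  moreover have "(\<sigma>, r) \<in> lie_pairs" if "\<forall>x\<in>L. \<forall>y\<in>L. ?F (br x y) = br (?F x) (?F y)"
  proof -
    have "\<sigma> (br x a) = br (\<sigma> x) a \<and> r (br x a) = br (r x) a" if "a \<in> \<gg>" "x \<in> V" for a x
      using module_iff[OF that] \<open>\<forall>x\<in>L. \<forall>y\<in>L. ?F (br x y) = br (?F x) (?F y)\<close> that
      by (simp add: L_mems F(4))
    then show ?thesis
      using p bracket_iff that unfolding lie_pairs_def GL_Hom_semidirect_def by (auto simp: L_mems)
  qed
  ultimately show ?thesis
    using Omega_GL[OF p] Omega_gg[OF p] by (auto simp: mem_lie_gal_iff)
qed

lemma lie_pairs_eq:
  "lie_pairs = {p \<in> carrier SD. \<Omega> p \<in> carrier (lie_gal_group smul L br \<gg>)}"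
proof -
  have "lie_pairs \<subseteq> carrier SD"
    by (auto simp: lie_pairs_def GL_Hom_semidirect_def)
  then show ?thesis
    using lie_pairs_iff by auto
qed

lemma subgroup_lie_gal_GL: "subgroup (carrier (lie_gal_group smul L br \<gg>)) (GL_group smul L)"
  using group.incl_subgroup[OF group_GL_group[OF carrier_subspace] subgroup_lie_aut]
    subgroup_lie_gal[OF gg_subset] by (simp add: lie_aut_group_eq)

lemma subgroup_lie_pairs: "subgroup lie_pairs SD"
proof -
  interpret group_hom SD "GL_group smul L" \<Omega>
    using group_SD group_GL_group[OF carrier_subspace] Omega_hom
    by (simp add: group_hom_def group_hom_axioms_def)
  show ?thesis
    unfolding lie_pairs_eq by (rule subgroup_vimage[OF subgroup_lie_gal_GL])
qed

text \<open>The preimage of \<open>f\<close> is the pair of the two components of \<open>f\<close> restricted to \<open>V\<close>.\<close>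

lemma Omega_surj:
  assumes "f \<in> carrier (lie_gal_group smul L br \<gg>)"
  shows "f \<in> \<Omega> ` carrier SD"
proof -
  have lin: "linear_map_on smul smul L L f" and bij: "bij_betw f L L"
    and ext: "f \<in> extensional L" and fix_gg: "\<And>a. a \<in> \<gg> \<Longrightarrow> f a = a"
    using assms by (auto simp: mem_lie_gal_iff GL_on_def)
  note f = linear_map_onD[OF lin] fix_gg
  have f_diff: "f (x - y) = f x - f y" if "x \<in> L" "y \<in> L" for x y
    by (rule linear_map_on_diff[OF lin]) (auto simp: that L_closed)
  define \<sigma> where "\<sigma> = (\<lambda>x\<in>V. f x - t (f x))"
  define r where "r = (\<lambda>x\<in>V. t (f x))"
  have "bij_betw \<sigma> V V"
  proof (rule bij_betw_imageI)
    show "inj_on \<sigma> V"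
    proof (rule inj_onI)
      fix x y assume xy: "x \<in> V" "y \<in> V" "\<sigma> x = \<sigma> y"
      \<comment> \<open>Equal values of \<open>\<sigma>\<close> put \<open>f (x - y)\<close> into
        \<open>\<gg>\<close>, where \<open>f\<close> is the identity. Injectivity of
        \<open>f\<close> then puts \<open>x - y\<close> itself into \<open>\<gg>\<close>, and an
        element of \<open>\<gg>\<close> and \<open>V\<close> is 0.\<close>
      then have "f (x - y) = t (f x) - t (f y)"
        by (simp add: \<sigma>_def f_diff L_mems algebra_simps)
      also have "\<dots> = f (t (f x) - t (f y))"
        using xy by (simp add: f retraction_simps L_mems)
      finally have "x - y = t (f x) - t (f y)"
        using inj_onD[OF bij_betw_imp_inj_on[OF bij]] xy by (simp add: f(1) retraction_simps L_mems)
      then have "t (x - y) = x - y"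
        using xy by (simp add: f retraction_simps L_mems)
      then show "x = y"
        using xy by (simp add: retraction_simps L_mems)
    qed
    have "v \<in> \<sigma> ` V" if v: "v \<in> V" for v
    proof -
      obtain y where y: "y \<in> L" "f y = v"
        using bij v V_L by (metis bij_betw_def imageE)
      \<comment> \<open>Subtracting \<open>t y\<close> moves the preimage into \<open>V\<close>. As
        \<open>f\<close> fixes \<open>t y\<close>, this changes only the invariant part of the
        value, which \<open>\<sigma>\<close> discards.\<close>
      have "\<sigma> (y - t y) = v"
        using y v by (simp add: \<sigma>_def diff_t_V f_diff f retraction_simps L_mems)
      then show ?thesis
        using diff_t_V[OF y(1)] by auto
    qed
    then show "\<sigma> ` V = V"
      by (auto simp: \<sigma>_def f diff_t_V V_L)
  qed
  then have SD: "(\<sigma>, r) \<in> carrier SD"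
    unfolding GL_Hom_semidirect_def GL_on_def Hom_on_def
    by (auto intro!: linear_map_onI simp: \<sigma>_def r_def f retraction_simps L_mems V_closed diff_t_V)
  have "\<Omega> (\<sigma>, r) y = f y" if y: "y \<in> L" for y
  proof -
    obtain a x where "a \<in> \<gg>" "x \<in> V" "y = a + x" using y by (rule decompose)
    then show ?thesis
      by (simp add: Omega_apply \<sigma>_def r_def f L_mems)
  qed
  then have "f = \<Omega> (\<sigma>, r)"
    using ext by (intro extensionalityI[of _ L]) (auto simp: artin_Omega_def)
  then show ?thesis
    using SD by auto
qed

lemma Omega_iso: "\<Omega> \<in> iso (SD\<lparr>carrier := lie_pairs\<rparr>) (lie_gal_group smul L br \<gg>)"
  unfolding iso_iff
proof (intro conjI)
  \<comment> \<open>The multiplications are those of \<open>SD\<close> and \<open>GL_group\<close>,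
    so \<open>Omega_hom\<close> restricts, and \<open>lie_pairs_eq\<close> places the values in the
    Galois group.\<close>
  show "\<Omega> \<in> hom (SD\<lparr>carrier := lie_pairs\<rparr>) (lie_gal_group smul L br \<gg>)"
    using Omega_hom
    by (auto simp: hom_def lie_pairs_eq lie_gal_group_def lie_aut_group_def GL_group_def)
  show "\<Omega> ` carrier (SD\<lparr>carrier := lie_pairs\<rparr>) = carrier (lie_gal_group smul L br \<gg>)"
    using Omega_surj by (auto simp: lie_pairs_eq)
  show "inj_on \<Omega> (carrier (SD\<lparr>carrier := lie_pairs\<rparr>))"
    using inj_on_Omega by (rule inj_on_subset) (auto simp: lie_pairs_eq)
qed

end

section \<open>The trace map of the group action as an equivariant retraction\<close>

lemma lie_retraction_trace:
  fixes smul :: "'k::field \<Rightarrow> 'h::ab_group_add \<Rightarrow> 'h"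
    and G :: "('g, 'm) monoid_scheme"
  assumes "lie_algebra smul L br"
    and "group G"
    and order: "(of_nat (order G) :: 'k) \<noteq> 0"
    and hom: "\<phi> \<in> hom G (lie_aut_group smul L br)"
  shows "lie_retraction smul L br (invariants L G \<phi>) (trace_map smul G \<phi>)
    (trace_kernel smul L G \<phi>) (trace_theta smul br G \<phi>) (trace_curly smul br G \<phi>)"
proof -
  interpret lie_algebra smul L br by fact
  interpret G: group G by fact
  let ?t = "trace_map smul G \<phi>" and ?inv = "invariants L G \<phi>"
  have aut: "\<phi> \<gamma> \<in> carrier (lie_aut_group smul L br)" if "\<gamma> \<in> carrier G" for \<gamma>
    using hom that by (auto simp: hom_def)
  then have lin: "linear_map_on smul smul L L (\<phi> \<gamma>)" if "\<gamma> \<in> carrier G" for \<gamma>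
    using that by (auto simp: lie_aut_group_eq GL_on_def)
  have br: "\<phi> \<gamma> (br x y) = br (\<phi> \<gamma> x) (\<phi> \<gamma> y)" if "\<gamma> \<in> carrier G" "x \<in> L" "y \<in> L" for \<gamma> x y
    using aut that by (auto simp: lie_aut_group_eq)
  note act = linear_map_onD[OF lin] linear_map_on_zero[OF lin L_closed(1)] br
  have mult: "\<phi> (\<gamma> \<otimes>\<^bsub>G\<^esub> \<delta>) x = \<phi> \<gamma> (\<phi> \<delta> x)"
    if "\<gamma> \<in> carrier G" "\<delta> \<in> carrier G" "x \<in> L" for \<gamma> \<delta> x
    using hom_mult[OF hom that(1,2)] that(3) by (simp add: lie_aut_group_def compose_def)
  have sum_L: "(\<Sum>\<gamma>\<in>carrier G. \<phi> \<gamma> x) \<in> L" if "x \<in> L" for x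
    using that by (intro L_closed(6)) (simp add: act)
  have t_inv: "?t x \<in> ?inv" if x: "x \<in> L" for x
  proof -
    have "\<phi> \<gamma> (\<Sum>\<delta>\<in>carrier G. \<phi> \<delta> x) = (\<Sum>\<delta>\<in>carrier G. \<phi> \<delta> x)" if \<gamma>: "\<gamma> \<in> carrier G" for \<gamma>
    proof -
      have "\<phi> \<gamma> (\<Sum>\<delta>\<in>carrier G. \<phi> \<delta> x) = (\<Sum>\<delta>\<in>carrier G. \<phi> \<gamma> (\<phi> \<delta> x))"
        using x by (intro linear_map_on_sum[OF lin[OF \<gamma>] carrier_subspace]) (simp add: act)
      also have "\<dots> = (\<Sum>\<delta>\<in>carrier G. \<phi> (\<gamma> \<otimes>\<^bsub>G\<^esub> \<delta>) x)"
        using x \<gamma> by (simp add: mult)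
      \<comment> \<open>Left translation by \<open>\<gamma>\<close> permutes the group.\<close>
      also have "\<dots> = (\<Sum>\<delta>\<in>carrier G. \<phi> \<delta> x)"
        using \<gamma> by (intro sum.reindex_bij_betw[of "\<lambda>\<delta>. \<gamma> \<otimes>\<^bsub>G\<^esub> \<delta>"])
          (simp add: bij_betw_def G.inj_on_cmult G.surj_const_mult)
      finally show ?thesis .
    qed
    then show ?thesis
      using x sum_L by (auto simp: invariants_def trace_map_def L_closed act)
  qed
  have t_id: "?t a = a" if "a \<in> ?inv" for a
  proof -
    have "(\<Sum>\<gamma>\<in>carrier G. \<phi> \<gamma> a) = (\<Sum>\<gamma>\<in>carrier G. a)"
      using that by (intro sum.cong) (auto simp: invariants_def)
    \<comment> \<open>The equal summands contribute the scalar \<open>order G\<close>, nonzero in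
      the field, which the normalising factor of the trace cancels.\<close>
    also have "\<dots> = smul (of_nat (order G)) a"
      by (simp add: order_def sum_constant_scale)
    finally show ?thesis
      using order by (simp add: trace_map_def)
  qed
  have t_br: "?t (br x a) = br (?t x) a" if x: "x \<in> L" and a: "a \<in> ?inv" for x a
  proof -
    have a': "a \<in> L" "\<And>\<gamma>. \<gamma> \<in> carrier G \<Longrightarrow> \<phi> \<gamma> a = a"
      using a by (auto simp: invariants_def)
    \<comment> \<open>Since \<open>a\<close> is fixed, each summand
      \<open>br (\<phi> \<gamma> x) a\<close> equals \<open>\<phi> \<gamma> (br x a)\<close>, so the
      sum is the one in the trace of \<open>br x a\<close>.\<close>
    have "br (\<Sum>\<gamma>\<in>carrier G. \<phi> \<gamma> x) a = (\<Sum>\<gamma>\<in>carrier G. br (\<phi> \<gamma> x) a)"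
      using x by (intro linear_map_on_sum[OF br_left[OF a'(1)] carrier_subspace]) (simp add: act)
    then show ?thesis
      using x a' sum_L[OF x] by (simp add: trace_map_def act br_simps)
  qed
  show ?thesis
  proof unfold_locales
    show "subspace ?inv"
      by (rule subspaceI) (auto simp: invariants_def L_closed act)
    show "linear_map_on smul smul L ?inv ?t"
    proof (rule linear_map_onI)
      fix x y c assume x: "x \<in> L"
      show "?t x \<in> ?inv" by (rule t_inv[OF x])
      show "?t (smul c x) = smul c (?t x)"
        using x by (simp add: trace_map_def act flip: scale_sum_right)
      show "?t (x + y) = ?t x + ?t y" if "y \<in> L"
        using x that by (simp add: trace_map_def act sum.distrib scale_right_distrib)
    qed
    show "?t a = a" if "a \<in> ?inv" for a
      by (rule t_id[OF that])
    show "?t (br x a) = br (?t x) a" if "x \<in> L" "a \<in> ?inv" for x a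
      by (rule t_br[OF that])
  \<comment> \<open>Each \<open>\<phi> \<gamma>\<close> preserves brackets, so
    \<open>trace_theta\<close> applied to \<open>x\<close> and \<open>y\<close> in \<open>L\<close>
    is the trace of \<open>br x y\<close>.\<close>
  qed (auto simp: trace_kernel_def trace_theta_def trace_curly_def trace_map_def
      act br_closed invariants_def)
qed

theorem theorem3p10:
  fixes smul :: "'k::field \<Rightarrow> 'h::ab_group_add \<Rightarrow> 'h"
    and L :: "'h set"
    and br :: "'h \<Rightarrow> 'h \<Rightarrow> 'h"
    and G :: "('g, 'm) monoid_scheme"
    and \<phi> :: "'g \<Rightarrow> 'h \<Rightarrow> 'h"
  assumes "lie_algebra smul L br"
    and "group G"
    and "finite (carrier G)"
    and "(of_nat (order G) :: 'k) \<noteq> 0"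
    and "\<phi> \<in> hom G (lie_aut_group smul L br)"
  shows "let \<gg> = invariants L G \<phi>;
             V = trace_kernel smul L G \<phi>;
             \<theta> = trace_theta smul br G \<phi>;
             curly = trace_curly smul br G \<phi>;
             cbr = skew_crossed_bracket br br \<theta> curly;
             SD = GL_Hom_semidirect smul smul V \<gg>;
             GG = artin_group smul L br G \<phi>;
             Gal = lie_gal_group smul L br \<gg>;
             \<Omega> = artin_Omega L \<gg> V
         in
           (skew_crossed_system smul \<gg> br smul V br \<theta> curly \<and>
            lie_algebra (module_prod.scale smul smul) (\<gg> \<times> V) cbr \<and>
            (\<forall>g\<in>\<gg>. \<forall>g'\<in>\<gg>. \<forall>x\<in>V. \<forall>x'\<in>V.
               cbr (g, x) (g', x') =
                 (br g g' + smul (inverse (of_nat (order G)))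
                              (\<Sum>\<gamma>\<in>carrier G. br (\<phi> \<gamma> x) (\<phi> \<gamma> x')),
                  br x x' - smul (inverse (of_nat (order G)))
                              (\<Sum>\<gamma>\<in>carrier G. br (\<phi> \<gamma> x) (\<phi> \<gamma> x'))
                    + br x g' - br x' g)) \<and>
            lie_iso (module_prod.scale smul smul) (\<gg> \<times> V) cbr smul L br (\<lambda>(g, x). g + x))
           \<and>
           (group SD \<and> subgroup (artin_pairs smul L br G \<phi>) SD \<and>
            group (lie_aut_group smul L br) \<and> subgroup (carrier Gal) (lie_aut_group smul L br) \<and>
            \<Omega> \<in> iso GG Gal \<and>
            (\<forall>(\<sigma>, r)\<in>carrier GG. \<forall>g\<in>\<gg>. \<forall>x\<in>V. \<Omega> (\<sigma>, r) (g + x) = g + r x + \<sigma> x))"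
proof -
  interpret R: lie_retraction smul L br "invariants L G \<phi>" "trace_map smul G \<phi>"
    "trace_kernel smul L G \<phi>" "trace_theta smul br G \<phi>" "trace_curly smul br G \<phi>"
    by (rule lie_retraction_trace[OF assms(1,2,4,5)])
  \<comment> \<open>With the trace data as parameters of the retraction, both sets unfold to the
    same term.\<close>
  have pairs: "artin_pairs smul L br G \<phi> = R.lie_pairs"
    unfolding artin_pairs_def R.lie_pairs_def Let_def ..
  show ?thesis
    unfolding Let_def artin_group_def pairs
    using R.skew_crossed_system R.lie_algebra_skew_crossed R.lie_iso_sum R.group_SD
      R.subgroup_lie_pairs R.group_lie_aut_group R.subgroup_lie_gal[OF R.gg_subset] R.Omega_iso
      R.Omega_apply
    by (auto simp: skew_crossed_bracket_def trace_theta_def trace_curly_def)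
qed

end
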